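(* For any composition $\boldsymbol{k}=(k_1,\ldots,k_r)$ and $k,r,m\in\mathbb{N}$, we have $$\begin{aligned} &\sum_{\substack{k_1+\cdots+k_r=k+r-1\\ k_1,\ldots,k_r\ge1}}\binom{k_r+m-2}{m-1}L_{z_0}\left(\begin{array}{c}z_1,\ldots,z_{r-1},z_r\\ k_1,\ldots,k_{r-1},k_r+m-1\end{array};x\right)\\ &\quad+\sum_{\substack{k_1+\cdots+k_r=m+r-1\\ k_1,\ldots,k_r\ge1}}\binom{k_r+k-2}{k-1}L_{z_0}\left(\begin{array}{c}z_1,\ldots,z_{r-1},z_r\\ k_1,\ldots,k_{r-1},k_r+k-1\end{array};x\right)\\ &=\sum_{j=1}^{r-1}(-1)^{j-1}L_{z_0}\left(\begin{array}{c}z_j,\ldots,z_2,z_1\\ 1,\ldots,1,k\end{array};x\right)L_{z_0}\left(\begin{array}{c}z_{j+1},\ldots,z_{r-1},z_r\\ 1,\ldots,1,m\end{array};x\right). \end{aligned}$$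
   Context: $\mathbb{N}$ is the set of positive integers. A composition is a finite sequence $(k_1,\ldots,k_r)\in\mathbb{N}^r$. In the two sums on the left, $k_1,\ldots,k_r$ are the summation indices. $z_j=z_j(t)$ ($j=1,2,\ldots,r$) are meromorphic functions of $t$ with at most logarithmic singularities, and $z_0=z_0(t)$ is a further function of $t$. Iterated integral: $\int_0^x f_1(t)dt\,f_2(t)dt\cdots f_n(t)dt:=\int_{0<t_1<\cdots<t_n<x}f_1(t_1)f_2(t_2)\cdots f_n(t_n)\,dt_1dt_2\cdots dt_n$. Formal multiple polylogarithm function: for functions $w_1,\ldots,w_d$ of this kind and positive integers $m_1,\ldots,m_d$, $$L_{z_0}\left(\begin{array}{c}w_1,\ldots,w_d\\ m_1,\ldots,m_d\end{array};x\right):=\int_0^x w_1(t)dt\,(z_0(t)dt)^{m_1-1}\cdots w_d(t)dt\,(z_0(t)dt)^{m_d-1},$$ where $(z_0(t)dt)^{n}$ denotes $n$ consecutive factors $z_0(t)dt$. In each factor on the right-hand side of the claim, the bottom row has as many entries as the top row, all equal to $1$ except the last.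
   Formalization: The printed identity is false (e.g. r=k=m=1, z_1=1); the second sum on the left is corrected to carry the sign (-1)^r and the reversed top row z_r,...,z_1. Absolute convergence of the integrals on the right-hand side is assumed explicitly. *)

theory Defs
  imports "HOL-Complex_Analysis.Meromorphic"
begin

definition ordered_simplex :: "nat \<Rightarrow> real \<Rightarrow> (nat \<Rightarrow> real) set" where
  "ordered_simplex n x =
     {t \<in> space (PiM {..<n} (\<lambda>_. lborel)).
        (\<forall>i<n. 0 < t i \<and> t i < x) \<and> (\<forall>i<n. \<forall>j<n. i < j \<longrightarrow> t i < t j)}"

text \<open>
  The list \<open>[f\<^sub>1, \<dots>, f\<^sub>n]\<close> stands for the word \<open>f\<^sub>1(t)dt \<cdots> f\<^sub>n(t)dt\<close>; its first letter
  carries the smallest variable.  The Bochner integral of a non-integrable function is \<open>0\<close>, so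
  convergence is a separate predicate.
\<close>

definition iterated_integral :: "(complex \<Rightarrow> complex) list \<Rightarrow> real \<Rightarrow> complex" where
  "iterated_integral fs x =
     (LINT t : ordered_simplex (length fs) x | PiM {..<length fs} (\<lambda>_. lborel).
        (\<Prod>i<length fs. (fs ! i) (of_real (t i))))"

definition iterated_integral_converges :: "(complex \<Rightarrow> complex) list \<Rightarrow> real \<Rightarrow> bool" where
  "iterated_integral_converges fs x \<longleftrightarrow>
     set_integrable (PiM {..<length fs} (\<lambda>_. lborel)) (ordered_simplex (length fs) x)
       (\<lambda>t. \<Prod>i<length fs. (fs ! i) (of_real (t i)))"

definition polylog_word ::
  "(complex \<Rightarrow> complex) \<Rightarrow> (complex \<Rightarrow> complex) list \<Rightarrow> nat list \<Rightarrow> (complex \<Rightarrow> complex) list" where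
  "polylog_word z0 ws ms = concat (map2 (\<lambda>w m. w # replicate (m - 1) z0) ws ms)"

definition formal_polylog ::
  "(complex \<Rightarrow> complex) \<Rightarrow> (complex \<Rightarrow> complex) list \<Rightarrow> nat list \<Rightarrow> real \<Rightarrow> complex" where
  "formal_polylog z0 ws ms x = iterated_integral (polylog_word z0 ws ms) x"

definition formal_polylog_converges ::
  "(complex \<Rightarrow> complex) \<Rightarrow> (complex \<Rightarrow> complex) list \<Rightarrow> nat list \<Rightarrow> real \<Rightarrow> bool" where
  "formal_polylog_converges z0 ws ms x \<longleftrightarrow> iterated_integral_converges (polylog_word z0 ws ms) x"

text \<open>
  A logarithmic singularity of the form \<open>f(t)dt\<close> is a simple pole of \<open>f\<close>.
\<close>

definition at_most_log_singularities :: "(complex \<Rightarrow> complex) \<Rightarrow> complex set \<Rightarrow> bool" where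
  "at_most_log_singularities f S \<longleftrightarrow>
     f meromorphic_on S \<and> (\<forall>p\<in>S. is_pole f p \<longrightarrow> zorder f p = - 1)"

definition compositions :: "nat \<Rightarrow> nat \<Rightarrow> nat list set" where
  "compositions n r = {ks. length ks = r \<and> (\<forall>i\<in>set ks. 1 \<le> i) \<and> sum_list ks = n}"

definition add_to_last :: "nat list \<Rightarrow> nat \<Rightarrow> nat list" where
  "add_to_last ks a = butlast ks @ [last ks + a]"

text \<open>
  The identity these notions serve is printed in its source with the second sum on its left-hand side
  written with sign \<open>+\<close> and top row \<open>z\<^sub>1, \<dots>, z\<^sub>r\<close>.  In that form it is false: for \<open>r = 1\<close> the
  right-hand side is the empty sum while the left-hand side need not vanish, and for \<open>r = 2\<close>, \<open>k = m = 1\<close>, \<open>x = 1\<close>, \<open>z\<^sub>1 = 1\<close>, \<open>z\<^sub>2 = t\<close> the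
  sides are \<open>2/3\<close> and \<open>1/2\<close>.  Shuffling the words on the right-hand side and telescoping leaves the
  second sum with sign \<open>(-1)\<^sup>r\<close> and top row \<open>z\<^sub>r, \<dots>, z\<^sub>1\<close>.
\<close>

end

theory Submission
  imports Defs
begin

text \<open>
  Put \<open>U\<^sub>j = z\<^sub>j \<cdots> z\<^sub>1 z\<^sub>0\<^bsup>k-1\<^esup>\<close> and \<open>V\<^sub>j = z\<^sub>j\<^sub>+\<^sub>1 \<cdots> z\<^sub>r z\<^sub>0\<^bsup>m-1\<^esup>\<close>.  The product of the iterated integrals
  of \<open>U\<^sub>j\<close> and \<open>V\<^sub>j\<close> is the sum over the shuffles of the two words, and splitting these by their first
  letter writes it as \<open>A\<^sub>j + A\<^sub>j\<^sub>+\<^sub>1\<close>, where \<open>A\<^sub>j\<close> collects the words \<open>z\<^sub>j w\<close> with \<open>w\<close> a shuffle of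
  \<open>U\<^sub>j\<^sub>-\<^sub>1\<close> and \<open>V\<^sub>j\<close>.  The alternating sum telescopes to \<open>A\<^sub>1 + (-1)\<^sup>r A\<^sub>r\<close>; in both remaining terms
  a power of \<open>z\<^sub>0\<close> is shuffled into a word, and counting multiplicities gives the binomial sums.

  The shuffle product formula itself comes from Fubini: up to the null set where two coordinates
  agree, a product of two ordered simplices is the disjoint union of the ordered simplices indexed by
  shuffles.  All integrands there are restrictions of one integrable function to measurable sets, so
  the single letters need not be measurable.
\<close>

section \<open>Sums over shuffles with multiplicity\<close>

text \<open>
  The library's \<^const>\<open>shuffles\<close> is a set of words; here every word counts with its multiplicity.
\<close>

fun shuffle_sum :: "('a list \<Rightarrow> 'b::comm_monoid_add) \<Rightarrow> 'a list \<Rightarrow> 'a list \<Rightarrow> 'b" where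
  "shuffle_sum g [] v = g v"
| "shuffle_sum g u [] = g u"
| "shuffle_sum g (a # u) (b # v) =
     shuffle_sum (\<lambda>w. g (a # w)) u (b # v) + shuffle_sum (\<lambda>w. g (b # w)) (a # u) v"

lemma shuffle_sum_Nil2 [simp]: "shuffle_sum g u [] = g u"
  by (cases u) auto

lemma shuffle_sum_commute: "shuffle_sum g u v = shuffle_sum g v u"
proof (induction u v arbitrary: g rule: shuffles.induct)
  case (3 a u b v)
  show ?case
    by (simp only: shuffle_sum.simps "3.IH") (rule add.commute)
qed simp_all

lemma shuffle_sum_cong:
  "(\<And>w. w \<in> shuffles u v \<Longrightarrow> g w = h w) \<Longrightarrow> shuffle_sum g u v = shuffle_sum h u v"
proof (induction u v arbitrary: g h rule: shuffles.induct)
  case (3 a u b v)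
  have "shuffle_sum (\<lambda>w. g (a # w)) u (b # v) = shuffle_sum (\<lambda>w. h (a # w)) u (b # v)"
    by (rule "3.IH"(1)) (simp add: "3.prems")
  moreover have "shuffle_sum (\<lambda>w. g (b # w)) (a # u) v = shuffle_sum (\<lambda>w. h (b # w)) (a # u) v"
    by (rule "3.IH"(2)) (simp add: "3.prems")
  ultimately show ?case
    by simp
qed simp_all

text \<open>Lets positions be shuffled in place of the letters or real numbers that stand at
  them.\<close>

lemma shuffle_sum_map:
  "shuffle_sum g (map f u) (map f v) = shuffle_sum (\<lambda>w. g (map f w)) u v"
  by (induction u v arbitrary: g rule: shuffles.induct) auto

lemma shuffle_sum_mult_left:
  "shuffle_sum (\<lambda>w. c * g w) u v = c * shuffle_sum g u v" for c :: "'a::semiring_0"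
  by (induction u v arbitrary: g rule: shuffles.induct) (auto simp: distrib_left)

text \<open>Sorts the shuffles by the number \<open>i\<close> of copies of \<open>c\<close> placed
  before \<open>w\<close>.\<close>

lemma shuffle_sum_replicate_Cons:
  "shuffle_sum g (replicate a c) (w # v) =
     (\<Sum>i\<le>a. shuffle_sum (\<lambda>u. g (replicate i c @ w # u)) (replicate (a - i) c) v)"
proof (induction a arbitrary: g)
  case (Suc a)
  show ?case
    using Suc[of "\<lambda>w. g (c # w)"] by (simp add: sum.atMost_Suc_shift add.commute del: sum.atMost_Suc)
qed simp

text \<open>All shuffles give the same word, so only their number matters. Splitting by the first
  letter is Pascal's rule, hence the nested induction on both exponents.\<close>

lemma shuffle_sum_replicate:
  "shuffle_sum g (replicate a c) (replicate b c) = of_nat (a + b choose b) * g (replicate (a + b) c)"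
  for g :: "'a list \<Rightarrow> 'b::semiring_1"
proof (induction a arbitrary: b g)
  case (Suc a)
  note IHa = Suc.IH
  show ?case
  proof (induction b arbitrary: g)
    case (Suc b)
    show ?case
      using IHa[of "\<lambda>w. g (c # w)" "Suc b"] Suc[of "\<lambda>w. g (c # w)"] by (simp add: algebra_simps)
  qed simp
qed simp

section \<open>Compositions and the binomial count\<close>

lemma finite_compositions: "finite (compositions n r)"
proof (rule finite_subset)
  show "compositions n r \<subseteq> {ks. set ks \<subseteq> {..n} \<and> length ks = r}"
    by (auto simp: compositions_def intro: member_le_sum_list)
  show "finite {ks. set ks \<subseteq> {..n} \<and> length ks = r}"
    by (intro finite_lists_length_eq) auto
qed

lemma sum_list_ge_length: "(\<And>i. i \<in> set ks \<Longrightarrow> 1 \<le> i) \<Longrightarrow> length ks \<le> sum_list ks" for ks :: "nat list"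
proof (induction ks)
  case (Cons k ks)
  then have "1 \<le> k" "length ks \<le> sum_list ks" by auto
  then show ?case by simp
qed simp

text \<open>A composition of \<open>a + Suc n\<close> into \<open>Suc n\<close> parts distributes an
  excess of \<open>a\<close> over the all-ones composition; \<open>i\<close> is the share of the
  first part.\<close>

lemma sum_compositions_Suc:
  "(\<Sum>ks\<in>compositions (a + Suc n) (Suc n). h ks) =
     (\<Sum>i\<le>a. \<Sum>ks\<in>compositions (a - i + n) n. h (Suc i # ks))"
proof -
  have "(\<Sum>i\<le>a. \<Sum>ks\<in>compositions (a - i + n) n. h (Suc i # ks)) =
      (\<Sum>(i, ks)\<in>(SIGMA i:{..a}. compositions (a - i + n) n). h (Suc i # ks))"
    by (intro sum.Sigma) (auto simp: finite_compositions)
  also have "\<dots> = (\<Sum>ks\<in>compositions (a + Suc n) (Suc n). h ks)"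
  proof (rule sum.reindex_bij_witness[where j = "\<lambda>(i, ks). Suc i # ks" and i = "\<lambda>ks. (hd ks - 1, tl ks)"])
    fix ks assume "ks \<in> compositions (a + Suc n) (Suc n)"
    then obtain k ks' where ks: "ks = Suc k # ks'" and l: "length ks' = n"
      "\<forall>i\<in>set ks'. 1 \<le> i" and s: "k + sum_list ks' = a + n"
      by (auto simp: compositions_def length_Suc_conv Suc_le_eq gr0_conv_Suc)
    \<comment> \<open>The remaining parts use up at least \<open>n\<close>, which forces
      \<open>k \<le> a\<close>.\<close>
    from sum_list_ge_length[of ks'] l have "n \<le> sum_list ks'" by auto
    with ks l s show "(hd ks - 1, tl ks) \<in> (SIGMA i:{..a}. compositions (a - i + n) n)"
      "(case (hd ks - 1, tl ks) of (i, ks) \<Rightarrow> Suc i # ks) = ks"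
      by (auto simp: compositions_def)
  qed (auto simp: compositions_def)
  finally show ?thesis ..
qed

lemma polylog_word_Cons:
  "polylog_word c (w # ws) (k # ks) = w # replicate (k - 1) c @ polylog_word c ws ks"
  by (simp add: polylog_word_def)

lemma polylog_word_ones:
  "ws \<noteq> [] \<Longrightarrow> polylog_word c ws (replicate (length ws - 1) 1 @ [k]) = ws @ replicate (k - 1) c"
proof (induction ws)
  case (Cons w ws)
  then show ?case
    by (cases ws) (auto simp: polylog_word_Cons, simp add: polylog_word_def)
qed simp

text \<open>The parts of \<open>ks\<close>, each lowered by one, count how many of the
  \<open>a\<close> new letters \<open>c\<close> follow each letter of \<open>w # ws\<close>. Behind
  the last letter, \<open>last ks - 1\<close> new copies are shuffled with the \<open>b\<close> old
  ones, whence the binomial coefficient.\<close>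

lemma shuffle_sum_replicate_append:
  fixes g :: "(complex \<Rightarrow> complex) list \<Rightarrow> 'b::semiring_1"
  shows "shuffle_sum (\<lambda>u. g (w # u)) (replicate a c) (ws @ replicate b c) =
    (\<Sum>ks\<in>compositions (a + Suc (length ws)) (Suc (length ws)).
       of_nat (last ks + b - 1 choose b) * g (polylog_word c (w # ws) (add_to_last ks b)))"
proof (induction ws arbitrary: g w a)
  case Nil
  have "compositions (a + 1) 1 = {[a + 1]}"
    by (auto simp: compositions_def length_Suc_conv)
  then show ?case
    by (simp add: shuffle_sum_replicate add_to_last_def polylog_word_def)
next
  case (Cons w' ws)
  have "shuffle_sum (\<lambda>u. g (w # replicate i c @ w' # u)) (replicate (a - i) c) (ws @ replicate b c) =
    (\<Sum>ks\<in>compositions (a - i + Suc (length ws)) (Suc (length ws)).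
       of_nat (last ks + b - 1 choose b) *
       g (w # replicate i c @ polylog_word c (w' # ws) (add_to_last ks b)))" for i
    by (rule Cons.IH)
  then have "shuffle_sum (\<lambda>u. g (w # u)) (replicate a c) ((w' # ws) @ replicate b c) =
    (\<Sum>i\<le>a. \<Sum>ks\<in>compositions (a - i + Suc (length ws)) (Suc (length ws)).
       of_nat (last ks + b - 1 choose b) *
       g (w # replicate i c @ polylog_word c (w' # ws) (add_to_last ks b)))"
    by (simp only: append_Cons shuffle_sum_replicate_Cons)
  \<comment> \<open>Here \<open>ks\<close> is nonempty, so prepending \<open>Suc i\<close> changes
    neither its last entry nor the effect of \<open>add_to_last\<close> on it.\<close>
  also have "\<dots> = (\<Sum>i\<le>a. \<Sum>ks\<in>compositions (a - i + Suc (length ws)) (Suc (length ws)).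
       of_nat (last (Suc i # ks) + b - 1 choose b) *
       g (polylog_word c (w # w' # ws) (add_to_last (Suc i # ks) b)))"
    by (intro sum.cong refl) (auto simp: compositions_def add_to_last_def polylog_word_Cons)
  finally show ?case
    unfolding length_Cons sum_compositions_Suc[of _ a "Suc (length ws)"] .
qed

section \<open>Lebesgue measure on products with named coordinates\<close>

interpretation lborel_product: product_sigma_finite "\<lambda>_::nat. lborel :: real measure"
  by standard

text \<open>
  \<open>distr_PiM_reindex\<close> in HOL-Probability requires probability spaces.
\<close>

lemma distr_PiM_lborel_reindex:
  fixes f :: "nat \<Rightarrow> nat"
  assumes "finite I" and f: "bij_betw f I J"
  shows "distr (PiM J (\<lambda>_. lborel)) (PiM I (\<lambda>_. lborel)) (\<lambda>t. \<lambda>i\<in>I. t (f i)) =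
    PiM I (\<lambda>_. lborel :: real measure)"
proof (rule lborel_product.PiM_eqI)
  fix A :: "nat \<Rightarrow> real set" assume A: "\<And>i. i \<in> I \<Longrightarrow> A i \<in> sets lborel"
  define g where "g = the_inv_into I f"
  have fI: "f i \<in> J" "g (f i) = i" if "i \<in> I" for i
    using f that by (auto simp: bij_betw_def g_def the_inv_into_f_f)
  have gJ: "g j \<in> I" "f (g j) = j" if "j \<in> J" for j
    using f that by (auto simp: bij_betw_def g_def f_the_inv_into_f the_inv_into_into)
  have [measurable]: "(\<lambda>t. \<lambda>i\<in>I. t (f i)) \<in> measurable (PiM J (\<lambda>_. lborel)) (PiM I (\<lambda>_. lborel :: real measure))"
    using fI by (intro measurable_restrict measurable_component_singleton) auto
  have fin: "finite J" using assms by (simp add: bij_betw_finite[symmetric])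
  \<comment> \<open>The preimage of a box is a box with the same sides, renamed along
    \<open>g\<close>; the two products of side lengths therefore agree.\<close>
  have "(\<lambda>t. \<lambda>i\<in>I. t (f i)) -` Pi\<^sub>E I A \<inter> space (PiM J (\<lambda>_. lborel)) = (\<Pi>\<^sub>E j\<in>J. A (g j))"
  proof (rule set_eqI)
    fix t
    have "(\<forall>i\<in>I. t (f i) \<in> A i) \<longleftrightarrow> (\<forall>j\<in>J. t j \<in> A (g j))"
      using fI gJ by metis
    then show "t \<in> (\<lambda>t. \<lambda>i\<in>I. t (f i)) -` Pi\<^sub>E I A \<inter> space (PiM J (\<lambda>_. lborel)) \<longleftrightarrow>
        t \<in> (\<Pi>\<^sub>E j\<in>J. A (g j))"
      by (auto simp: space_PiM PiE_iff)
  qed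
  then have "emeasure (distr (PiM J (\<lambda>_. lborel)) (PiM I (\<lambda>_. lborel)) (\<lambda>t. \<lambda>i\<in>I. t (f i))) (Pi\<^sub>E I A) =
      (\<Prod>j\<in>J. emeasure lborel (A (g j)))"
    using A gJ \<open>finite I\<close> fin
    by (subst emeasure_distr) (auto intro!: sets_PiM_I_finite lborel_product.emeasure_PiM)
  also have "\<dots> = (\<Prod>i\<in>I. emeasure lborel (A i))"
    using fI by (simp flip: prod.reindex_bij_betw[OF f])
  finally show "emeasure (distr (PiM J (\<lambda>_. lborel)) (PiM I (\<lambda>_. lborel)) (\<lambda>t. \<lambda>i\<in>I. t (f i))) (Pi\<^sub>E I A) =
      (\<Prod>i\<in>I. emeasure lborel (A i))" .
qed (use assms in simp_all)

text \<open>The integrand sees only the list of coordinate values, so renaming coordinates is a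
  measure-preserving change of variables. It carries the standard indices \<open>0, 1, ...\<close>
  to any other order.\<close>

lemma integral_PiM_lborel_relabel:
  fixes h :: "real list \<Rightarrow> complex" and ks ls :: "nat list"
  assumes "distinct ks" "distinct ls" "length ks = length ls"
    and int: "integrable (PiM (set ks) (\<lambda>_. lborel)) (\<lambda>t. h (map t ks))"
  shows "integrable (PiM (set ls) (\<lambda>_. lborel)) (\<lambda>t. h (map t ls))"
    and "(LINT t|PiM (set ls) (\<lambda>_. lborel). h (map t ls)) =
      (LINT t|PiM (set ks) (\<lambda>_. lborel). h (map t ks))"
proof -
  define f where "f = (\<lambda>k. the (map_of (zip ks ls) k))"
  have nth: "f (ks ! i) = ls ! i" if "i < length ks" for i
    using assms that by (simp add: f_def map_of_zip_nth)
  have map: "map f ks = ls"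
    using assms(3) nth by (intro nth_equalityI) auto
  have f: "bij_betw f (set ks) (set ls)"
    using assms(2) distinct_map[of f ks] map by (auto simp: bij_betw_def)
  let ?\<phi> = "\<lambda>t. \<lambda>k\<in>set ks. t (f k)"
  have \<phi>: "?\<phi> \<in> measurable (PiM (set ls) (\<lambda>_. lborel)) (PiM (set ks) (\<lambda>_. lborel :: real measure))"
    using f by (intro measurable_restrict measurable_component_singleton) (auto simp: bij_betw_def)
  have eq: "map (?\<phi> t) ks = map t ls" for t :: "nat \<Rightarrow> real"
    by (simp flip: map)
  note D = distr_PiM_lborel_reindex[OF finite_set f] and m = borel_measurable_integrable[OF int]
  show "integrable (PiM (set ls) (\<lambda>_. lborel)) (\<lambda>t. h (map t ls))"
    using integrable_distr_eq[OF \<phi> m, unfolded D] int by (simp add: eq)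
  show "(LINT t|PiM (set ls) (\<lambda>_. lborel). h (map t ls)) =
      (LINT t|PiM (set ks) (\<lambda>_. lborel). h (map t ks))"
    using integral_distr[OF \<phi> m, unfolded D] by (simp add: eq)
qed

lemma (in pair_sigma_finite) integrable_mult_pair:
  fixes f :: "'a \<Rightarrow> complex" and g :: "'b \<Rightarrow> complex"
  assumes f: "integrable M1 f" and g: "integrable M2 g"
  shows "integrable (M1 \<Otimes>\<^sub>M M2) (\<lambda>p. f (fst p) * g (snd p))"
    and "(LINT p|(M1 \<Otimes>\<^sub>M M2). f (fst p) * g (snd p)) = integral\<^sup>L M1 f * integral\<^sup>L M2 g"
proof -
  note [measurable] = borel_measurable_integrable[OF f] borel_measurable_integrable[OF g]
  show int: "integrable (M1 \<Otimes>\<^sub>M M2) (\<lambda>p. f (fst p) * g (snd p))"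
    by (rule Fubini_integrable) (use f g in \<open>auto simp: norm_mult\<close>)
  show "(LINT p|(M1 \<Otimes>\<^sub>M M2). f (fst p) * g (snd p)) = integral\<^sup>L M1 f * integral\<^sup>L M2 g"
    using integral_fst'[OF int, symmetric] f g by simp
qed

lemma integral_PiM_lborel_mult:
  fixes f g :: "(nat \<Rightarrow> real) \<Rightarrow> complex"
  assumes "finite I" "finite J" "I \<inter> J = {}"
    and f: "integrable (PiM I (\<lambda>_. lborel)) f" and g: "integrable (PiM J (\<lambda>_. lborel)) g"
  shows "integrable (PiM (I \<union> J) (\<lambda>_. lborel)) (\<lambda>t. f (restrict t I) * g (restrict t J))"
    and "(LINT t|PiM (I \<union> J) (\<lambda>_. lborel). f (restrict t I) * g (restrict t J)) =
      integral\<^sup>L (PiM I (\<lambda>_. lborel)) f * integral\<^sup>L (PiM J (\<lambda>_. lborel)) g"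
proof -
  interpret I: finite_product_sigma_finite "\<lambda>_. lborel" I by standard fact
  interpret J: finite_product_sigma_finite "\<lambda>_. lborel" J by standard fact
  interpret pair_sigma_finite "PiM I (\<lambda>_. lborel :: real measure)" "PiM J (\<lambda>_. lborel :: real measure)"
    by standard
  let ?P = "PiM I (\<lambda>_. lborel :: real measure) \<Otimes>\<^sub>M PiM J (\<lambda>_. lborel :: real measure)"
  note D = lborel_product.distr_merge[OF assms(3,1,2)]
  note [measurable] = borel_measurable_integrable[OF f] borel_measurable_integrable[OF g]
  have m: "(\<lambda>t. f (restrict t I) * g (restrict t J)) \<in> borel_measurable (PiM (I \<union> J) (\<lambda>_. lborel))"
    by measurable
  \<comment> \<open>Points of a product space are extensional, so restricting a merged point returns
    its two components exactly.\<close>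
  have eq: "f (restrict (merge I J p) I) * g (restrict (merge I J p) J) = f (fst p) * g (snd p)"
    if "p \<in> space ?P" for p
    using that assms(3) by (cases p) (auto simp: space_pair_measure space_PiM PiE_restrict)
  show "integrable (PiM (I \<union> J) (\<lambda>_. lborel)) (\<lambda>t. f (restrict t I) * g (restrict t J))"
    using integrable_distr_eq[OF measurable_merge m, unfolded D] integrable_mult_pair(1)[OF f g]
    by (simp add: eq cong: Bochner_Integration.integrable_cong)
  show "(LINT t|PiM (I \<union> J) (\<lambda>_. lborel). f (restrict t I) * g (restrict t J)) =
      integral\<^sup>L (PiM I (\<lambda>_. lborel)) f * integral\<^sup>L (PiM J (\<lambda>_. lborel)) g"
    using integral_distr[OF measurable_merge m, unfolded D] integrable_mult_pair(2)[OF f g]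
    by (simp add: eq cong: Bochner_Integration.integral_cong)
qed

text \<open>Integrate coordinate \<open>i\<close> first: each slice of the diagonal is the single
  point \<open>t j\<close>, a null set.\<close>

lemma AE_PiM_lborel_neq:
  assumes "finite I" "i \<in> I" "j \<in> I" "i \<noteq> j"
  shows "AE t in PiM I (\<lambda>_. lborel :: real measure). t i \<noteq> t (j :: nat)"
proof -
  define K where "K = I - {i}"
  have I: "I = insert i K" and K: "finite K" "i \<notin> K" "j \<in> K"
    using assms by (auto simp: K_def)
  let ?f = "\<lambda>t :: nat \<Rightarrow> real. indicator {t. t i = t j} t :: ennreal"
  have m: "(\<lambda>t. t i) \<in> borel_measurable (PiM (insert i K) (\<lambda>_. lborel :: real measure))"
    "(\<lambda>t. t j) \<in> borel_measurable (PiM (insert i K) (\<lambda>_. lborel :: real measure))"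
    using measurable_component_singleton[of i "insert i K" "\<lambda>_. lborel :: real measure"]
      measurable_component_singleton[of j "insert i K" "\<lambda>_. lborel :: real measure"] K by simp_all
  have fm[measurable]: "?f \<in> borel_measurable (PiM (insert i K) (\<lambda>_. lborel))"
    by (intro borel_measurable_indicator') (use borel_measurable_eq[OF m] in simp)
  have "(\<integral>\<^sup>+t. ?f t \<partial>PiM (insert i K) (\<lambda>_. lborel)) =
      (\<integral>\<^sup>+t. (\<integral>\<^sup>+y. ?f (t(i := y)) \<partial>lborel) \<partial>PiM K (\<lambda>_. lborel))"
    by (rule lborel_product.product_nn_integral_insert[OF K(1,2) fm])
  also have "\<dots> = (\<integral>\<^sup>+t. (\<integral>\<^sup>+y. indicator {t j :: real} y \<partial>lborel) \<partial>PiM K (\<lambda>_. lborel))"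
    by (intro nn_integral_cong) (use assms(4) in \<open>auto simp: indicator_def\<close>)
  also have "\<dots> = 0"
    by simp
  finally have "AE t in PiM (insert i K) (\<lambda>_. lborel). ?f t = 0"
    by (subst (asm) nn_integral_0_iff_AE) auto
  then show ?thesis
    unfolding I by eventually_elim (auto simp: indicator_def split: if_splits)
qed

section \<open>Iterated integrals as integrals over coordinate lists\<close>

text \<open>The ordered simplex as a condition on the list of values, so that a reordering of the
  coordinates acts through \<open>map\<close>.\<close>

definition increasing_below :: "real \<Rightarrow> real list \<Rightarrow> bool" where
  "increasing_below x ts \<longleftrightarrow> sorted_wrt (<) ts \<and> set ts \<subseteq> {0<..<x}"

text \<open>Extended by zero off the simplex, so that words with different coordinate orders are
  integrated over one common space.\<close>

definition word_integrand :: "(complex \<Rightarrow> complex) list \<Rightarrow> real \<Rightarrow> real list \<Rightarrow> complex" where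
  "word_integrand fs x ts =
     of_bool (increasing_below x ts) * prod_list (map2 (\<lambda>f y. f (of_real y)) fs ts)"

lemma simplex_integrand_eq:
  assumes "t \<in> space (PiM {..<length fs} (\<lambda>_. lborel))"
  shows "indicator (ordered_simplex (length fs) x) t *\<^sub>R (\<Prod>i<length fs. (fs ! i) (of_real (t i))) =
    word_integrand fs x (map t [0..<length fs])"
proof -
  have "increasing_below x (map t [0..<length fs]) \<longleftrightarrow> t \<in> ordered_simplex (length fs) x"
    using assms
    by (auto simp: increasing_below_def ordered_simplex_def sorted_wrt_iff_nth_less image_subset_iff)
  moreover have "prod_list (map2 (\<lambda>f y. f (of_real y)) fs (map t [0..<length fs])) =
      (\<Prod>i<length fs. (fs ! i) (of_real (t i)))"
    by (simp add: prod.list_conv_set_nth atLeast0LessThan)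
  ultimately show ?thesis
    by (simp add: word_integrand_def)
qed

lemma iterated_integral_altdef:
  "iterated_integral fs x =
     (LINT t|PiM {..<length fs} (\<lambda>_. lborel). word_integrand fs x (map t [0..<length fs]))"
  unfolding iterated_integral_def set_lebesgue_integral_def
  by (intro Bochner_Integration.integral_cong refl simplex_integrand_eq)

lemma iterated_integral_converges_altdef:
  "iterated_integral_converges fs x \<longleftrightarrow>
     integrable (PiM {..<length fs} (\<lambda>_. lborel)) (\<lambda>t. word_integrand fs x (map t [0..<length fs]))"
  unfolding iterated_integral_converges_def set_integrable_def
  by (intro Bochner_Integration.integrable_cong refl simplex_integrand_eq)

section \<open>Strictly increasing shuffles\<close>

text \<open>Two strictly increasing lists without common entries have exactly one strictly
  increasing shuffle, their merge; if either list is not increasing, there is none.\<close>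

lemma shuffle_sum_sorted:
  fixes us vs :: "real list"
  shows "set us \<inter> set vs = {} \<Longrightarrow>
    shuffle_sum (\<lambda>w. of_bool (sorted_wrt (<) w)) us vs =
      (of_bool (sorted_wrt (<) us \<and> sorted_wrt (<) vs) :: complex)"
proof (induction us vs rule: shuffles.induct)
  case (3 a us b vs)
  \<comment> \<open>Whether \<open>c\<close> lies below all later entries depends only on their set,
    which all shuffles share, so this condition factors out.\<close>
  have *: "shuffle_sum (\<lambda>w. of_bool (sorted_wrt (<) (c # w))) xs ys =
      of_bool (\<forall>y\<in>set xs \<union> set ys. c < y) * (shuffle_sum (\<lambda>w. of_bool (sorted_wrt (<) w)) xs ys :: complex)"
    for c and xs ys :: "real list"
    by (subst shuffle_sum_mult_left[symmetric], rule shuffle_sum_cong) (auto simp: set_shuffles)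
  have "set us \<inter> set (b # vs) = {}" "set (a # us) \<inter> set vs = {}" "a \<noteq> b"
    using "3.prems" by auto
  \<comment> \<open>As \<open>a\<close> and \<open>b\<close> differ, only the smaller one can come
    first, and at most one summand survives.\<close>
  then show ?case
    by (simp only: shuffle_sum.simps * "3.IH") (auto simp: of_bool_def, metis linorder_not_less order_less_le_trans order_less_trans)
qed auto

lemma shuffle_sum_increasing_below:
  assumes "set us \<inter> set vs = {}"
  shows "shuffle_sum (\<lambda>w. of_bool (increasing_below x w)) us vs =
      (of_bool (increasing_below x us) * of_bool (increasing_below x vs) :: complex)"
proof -
  have "shuffle_sum (\<lambda>w. of_bool (increasing_below x w)) us vs =
    shuffle_sum (\<lambda>w. of_bool (set us \<union> set vs \<subseteq> {0<..<x}) * (of_bool (sorted_wrt (<) w) :: complex)) us vs"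
    by (rule shuffle_sum_cong) (auto simp: increasing_below_def set_shuffles)
  also have "\<dots> = of_bool (increasing_below x us) * of_bool (increasing_below x vs)"
    by (subst shuffle_sum_mult_left, subst shuffle_sum_sorted[OF assms]) (auto simp: increasing_below_def)
  finally show ?thesis .
qed

text \<open>Both words are subsequences of every shuffle. Geometrically, the simplex of a shuffle
  lies in the product of the two simplices.\<close>

lemma sorted_wrt_shuffles:
  "w \<in> shuffles u v \<Longrightarrow> sorted_wrt R w \<Longrightarrow> sorted_wrt R u \<and> sorted_wrt R v"
  by (induction u v arbitrary: w rule: shuffles.induct) (auto simp: set_shuffles)

lemma prod_list_shuffles:
  fixes f :: "'a \<Rightarrow> 'b::comm_monoid_mult"
  shows "w \<in> shuffles u v \<Longrightarrow> prod_list (map f w) = prod_list (map f u) * prod_list (map f v)"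
  by (induction u v arbitrary: w rule: shuffles.induct) (auto simp: ac_simps)

lemma integral_shuffle_sum:
  fixes G :: "'a list \<Rightarrow> 't \<Rightarrow> complex"
  assumes "\<And>w. w \<in> shuffles u v \<Longrightarrow> integrable M (G w)"
  shows "integrable M (\<lambda>t. shuffle_sum (\<lambda>w. G w t) u v) \<and>
    (LINT t|M. shuffle_sum (\<lambda>w. G w t) u v) = shuffle_sum (\<lambda>w. integral\<^sup>L M (G w)) u v"
  using assms
proof (induction u v arbitrary: G rule: shuffles.induct)
  case (3 a u b v)
  from "3.IH"(1)[of "\<lambda>w. G (a # w)"] "3.IH"(2)[of "\<lambda>w. G (b # w)"] "3.prems"
  show ?case by auto
qed auto

lemma word_integrand_map:
  "word_integrand (map F ls) x (map t ls) =
     of_bool (increasing_below x (map t ls)) * prod_list (map (\<lambda>i. F i (of_real (t i))) ls)"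
proof -
  have "map2 (\<lambda>f y. f (of_real y)) (map F ls) (map t ls) = map (\<lambda>i. F i (of_real (t i))) ls"
    by (induction ls) auto
  then show ?thesis
    by (simp only: word_integrand_def)
qed

text \<open>Finitely many strict inequalities cut out the simplex. Its measurability makes
  restrictions of an integrable function to it integrable.\<close>

lemma sets_increasing_below:
  "{t \<in> space (PiM (set ls) (\<lambda>_. lborel)). increasing_below x (map t ls)} \<in> sets (PiM (set ls) (\<lambda>_. lborel :: real measure))"
proof -
  have "increasing_below x (map t ls) \<longleftrightarrow>
     (\<forall>i\<in>{..<length ls}. \<forall>j\<in>{..<length ls}. i < j \<longrightarrow> t (ls ! i) < t (ls ! j)) \<and> (\<forall>l\<in>set ls. 0 < t l \<and> t l < x)"
     for t
    by (auto simp: increasing_below_def sorted_wrt_iff_nth_less)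
  moreover have [measurable]: "(\<lambda>t. t l) \<in> borel_measurable (PiM (set ls) (\<lambda>_. lborel :: real measure))"
    if "l \<in> set ls" for l
    using measurable_component_singleton[OF that, of "\<lambda>_. lborel :: real measure"] by simp
  ultimately show ?thesis
    by simp
qed

section \<open>The shuffle product formula\<close>

theorem iterated_integral_mult:
  assumes u: "iterated_integral_converges u x" and v: "iterated_integral_converges v x"
  shows "iterated_integral u x * iterated_integral v x = shuffle_sum (\<lambda>w. iterated_integral w x) u v"
proof -
  define p q F ks ls where "p = length u" and "q = length v" and "F = (\<lambda>i. (u @ v) ! i)"
    and "ks = [0..<p]" and "ls = [p..<p + q]"
  \<comment> \<open>Letters may repeat, so the positions of the letters are shuffled instead: each of them names a
    coordinate of the product measure.\<close>
  have map_F: "map F ks = u" "map F ls = v"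
    by (auto simp: F_def ks_def ls_def p_def q_def nth_append intro!: nth_equalityI)
  have idx: "distinct ks" "distinct ls" "set ks \<inter> set ls = {}" "length ks = p" "length ls = q"
    by (auto simp: ks_def ls_def)
  have u': "integrable (PiM (set ks) (\<lambda>_. lborel)) (\<lambda>t. word_integrand u x (map t ks))"
    "(LINT t|PiM (set ks) (\<lambda>_. lborel). word_integrand u x (map t ks)) = iterated_integral u x"
    using u by (simp_all add: iterated_integral_altdef iterated_integral_converges_altdef ks_def p_def
        atLeast0LessThan)
  \<comment> \<open>The integral of \<open>v\<close> is defined with indices from \<open>0\<close>;
    it is moved to indices from \<open>p\<close>, disjoint from those of \<open>u\<close>.\<close>
  have v': "integrable (PiM (set ls) (\<lambda>_. lborel)) (\<lambda>t. word_integrand v x (map t ls))"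
    "(LINT t|PiM (set ls) (\<lambda>_. lborel). word_integrand v x (map t ls)) = iterated_integral v x"
    using integral_PiM_lborel_relabel[of "[0..<q]" ls "word_integrand v x"] v idx
    by (simp_all add: iterated_integral_altdef iterated_integral_converges_altdef q_def atLeast0LessThan)
  define N where "N = PiM (set ks \<union> set ls) (\<lambda>_. lborel :: real measure)"
  define P where "P = (\<lambda>t. word_integrand u x (map t ks) * word_integrand v x (map t ls))"
  define G where "G = (\<lambda>w t. word_integrand (map F w) x (map t w))"
  have restrict: "map (restrict t (set l)) l = map t l" for t :: "nat \<Rightarrow> real" and l
    by simp
  have P: "integrable N P" "integral\<^sup>L N P = iterated_integral u x * iterated_integral v x"
    using integral_PiM_lborel_mult[OF _ _ idx(3) u'(1) v'(1)] u'(2) v'(2)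
    by (simp_all add: N_def P_def restrict)
  have G: "integrable N (G w)" "integral\<^sup>L N (G w) = iterated_integral (map F w) x"
    if w: "w \<in> shuffles ks ls" for w
  proof -
    have dw: "distinct w" and sw: "set w = set ks \<union> set ls" and lw: "length w = p + q"
      using w idx by (auto simp: set_shuffles length_shuffles intro: distinct_disjoint_shuffles)
    let ?A = "{t \<in> space N. increasing_below x (map t w)}"
    have A: "?A \<in> sets N"
      using sets_increasing_below[of w x] by (simp add: N_def sw)
    \<comment> \<open>On \<open>?A\<close> both factors of \<open>P\<close> have their order
      condition satisfied, and the product of the letters does not depend on their order. Hence
      convergence of each shuffled word is inherited from \<open>P\<close>.\<close>
    have eq: "G w t = indicator ?A t *\<^sub>R P t" if "t \<in> space N" for t
    proof (cases "increasing_below x (map t w)")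
      case True
      then have "increasing_below x (map t ks)" "increasing_below x (map t ls)"
        using sorted_wrt_shuffles[OF w, of "\<lambda>i j. t i < t j"] sw
        by (auto simp: increasing_below_def sorted_wrt_map)
      then show ?thesis
        using True that
        by (simp add: G_def P_def word_integrand_map prod_list_shuffles[OF w] flip: map_F)
    next
      case False
      then show ?thesis
        by (simp add: G_def word_integrand_map)
    qed
    show int: "integrable N (G w)"
      using integrable_mult_indicator[OF A P(1)] eq
      by (simp cong: Bochner_Integration.integrable_cong)
    have "{0..<p + q} = {..<length (map F w)}"
      using lw by auto
    \<comment> \<open>Renaming the coordinates in the order of \<open>w\<close> to
      \<open>0, 1, ...\<close> turns this into the defining integral of the word.\<close>
    then show "integral\<^sup>L N (G w) = iterated_integral (map F w) x"
      using integral_PiM_lborel_relabel(2)[of w "[0..<p + q]" "word_integrand (map F w) x"] dw lw int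
      by (simp add: iterated_integral_altdef N_def G_def sw)
  qed
  \<comment> \<open>At a tie between the two blocks no shuffle is strictly increasing, although each
    block may be.\<close>
  have "AE t in N. \<forall>i\<in>set ks. \<forall>j\<in>set ls. t i \<noteq> t j"
    unfolding N_def using idx(3)
    by (intro AE_finite_allI finite_set AE_PiM_lborel_neq) auto
  then have ae: "AE t in N. P t = shuffle_sum (\<lambda>w. G w t) ks ls"
  proof eventually_elim
    case (elim t)
    let ?f = "\<lambda>i. F i (of_real (t i))"
    \<comment> \<open>The product of the letters is common to all shuffles and factors out; what
      remains counts the increasing ones.\<close>
    have "shuffle_sum (\<lambda>w. G w t) ks ls = shuffle_sum (\<lambda>w.
        (prod_list (map ?f ks) * prod_list (map ?f ls)) * of_bool (increasing_below x (map t w))) ks ls"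
      by (rule shuffle_sum_cong) (simp add: G_def word_integrand_map prod_list_shuffles[of _ ks ls])
    also have "\<dots> = (prod_list (map ?f ks) * prod_list (map ?f ls)) *
        shuffle_sum (\<lambda>w. of_bool (increasing_below x w)) (map t ks) (map t ls)"
      by (simp add: shuffle_sum_mult_left shuffle_sum_map)
    also have "shuffle_sum (\<lambda>w. of_bool (increasing_below x w)) (map t ks) (map t ls) =
        (of_bool (increasing_below x (map t ks)) * of_bool (increasing_below x (map t ls)) :: complex)"
      by (rule shuffle_sum_increasing_below) (use elim in auto)
    finally show ?case
      by (simp add: P_def word_integrand_map flip: map_F)
  qed
  have S: "integrable N (\<lambda>t. shuffle_sum (\<lambda>w. G w t) ks ls)"
    "(LINT t|N. shuffle_sum (\<lambda>w. G w t) ks ls) = shuffle_sum (\<lambda>w. integral\<^sup>L N (G w)) ks ls"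
    using integral_shuffle_sum[of ks ls N G] G(1) by auto
  have "iterated_integral u x * iterated_integral v x = (LINT t|N. shuffle_sum (\<lambda>w. G w t) ks ls)"
    unfolding P(2)[symmetric] by (rule integral_cong_AE) (use P(1) S(1) ae in auto)
  also have "\<dots> = shuffle_sum (\<lambda>w. iterated_integral (map F w) x) ks ls"
    unfolding S(2) by (rule shuffle_sum_cong) (rule G(2))
  also have "\<dots> = shuffle_sum (\<lambda>w. iterated_integral w x) u v"
    using shuffle_sum_map[of "\<lambda>w. iterated_integral w x" F ks ls] by (simp only: map_F)
  finally show ?thesis .
qed

section \<open>Telescoping the alternating sum\<close>

theorem theorem3p7:
  fixes z0 :: "complex \<Rightarrow> complex" and z :: "nat \<Rightarrow> complex \<Rightarrow> complex"
    and x :: real and k r m :: nat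
  assumes "k \<ge> 1" and "r \<ge> 1" and "m \<ge> 1"
    and "\<And>j. j \<in> {1..r} \<Longrightarrow> at_most_log_singularities (z j) (of_real ` {0..x})"
    and "\<And>j. j \<in> {1..r-1} \<Longrightarrow>
           formal_polylog_converges z0 (rev (map z [1..<j+1])) (replicate (j-1) 1 @ [k]) x"
    and "\<And>j. j \<in> {1..r-1} \<Longrightarrow>
           formal_polylog_converges z0 (map z [j+1..<r+1]) (replicate (r-j-1) 1 @ [m]) x"
  shows "(\<Sum>ks\<in>compositions (k+r-1) r.
            of_nat ((last ks + m - 2) choose (m-1)) *
              formal_polylog z0 (map z [1..<r+1]) (add_to_last ks (m-1)) x)
       + (-1)^r * (\<Sum>ks\<in>compositions (m+r-1) r.
            of_nat ((last ks + k - 2) choose (k-1)) *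
              formal_polylog z0 (rev (map z [1..<r+1])) (add_to_last ks (k-1)) x)
       = (\<Sum>j=1..r-1. (-1)^(j-1) *
            formal_polylog z0 (rev (map z [1..<j+1])) (replicate (j-1) 1 @ [k]) x *
            formal_polylog z0 (map z [j+1..<r+1]) (replicate (r-j-1) 1 @ [m]) x)"
proof -
  define I where "I = (\<lambda>w. iterated_integral w x)"
  define U where "U = (\<lambda>j. rev (map z [1..<j+1]) @ replicate (k - 1) z0)"
  define V where "V = (\<lambda>j. map z [j+1..<r+1] @ replicate (m - 1) z0)"
  \<comment> \<open>The boundary words \<open>U 0\<close> and \<open>V r\<close> are pure powers of
    \<open>z0\<close>, so \<open>A 1\<close> and \<open>A r\<close> are the sums evaluated
    below.\<close>
  define A where "A = (\<lambda>j. shuffle_sum (\<lambda>w. I (z j # w)) (U (j - 1)) (V j))"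
  have U: "polylog_word z0 (rev (map z [1..<j+1])) (replicate (j-1) 1 @ [k]) = U j"
    if "j \<in> {1..r-1}" for j
    using polylog_word_ones[of "rev (map z [1..<j+1])" z0 k] that by (simp add: U_def)
  have V: "polylog_word z0 (map z [j+1..<r+1]) (replicate (r-j-1) 1 @ [m]) = V j"
    if "j \<in> {1..r-1}" for j
  proof -
    have "j < r" using that by auto
    then show ?thesis
      using polylog_word_ones[of "map z [j+1..<r+1]" z0 m] by (simp add: V_def del: upt_Suc)
  qed
  have A_first: "A 1 = (\<Sum>ks\<in>compositions (k+r-1) r. of_nat ((last ks + m - 2) choose (m-1)) *
              formal_polylog z0 (map z [1..<r+1]) (add_to_last ks (m-1)) x)"
  proof -
    have ws: "map z [1..<r+1] = z 1 # map z [2..<r+1]"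
      using \<open>r \<ge> 1\<close> by (simp add: upt_conv_Cons numeral_2_eq_2 del: upt_Suc)
    \<comment> \<open>With \<open>a = k - 1\<close> and \<open>b = m - 1\<close>, the
      \<open>r - 1\<close> letters after \<open>z 1\<close> give compositions of
      \<open>k + r - 1\<close> into \<open>r\<close> parts.\<close>
    show ?thesis
      using shuffle_sum_replicate_append[of I "z 1" "k - 1" z0 "map z [2..<r+1]" "m - 1"] assms(1-3)
      unfolding A_def U_def V_def formal_polylog_def ws
      by (simp add: I_def numeral_2_eq_2 del: upt_Suc)
  qed
  have A_last: "A r = (\<Sum>ks\<in>compositions (m+r-1) r. of_nat ((last ks + k - 2) choose (k-1)) *
              formal_polylog z0 (rev (map z [1..<r+1])) (add_to_last ks (k-1)) x)"
  proof -
    have ws: "rev (map z [1..<r+1]) = z r # rev (map z [1..<r])"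
      using \<open>r \<ge> 1\<close> by simp
    \<comment> \<open>Now the pure power is \<open>V r\<close>, the second argument; exchanging the
      arguments brings it to the front.\<close>
    show ?thesis
      using shuffle_sum_replicate_append[of I "z r" "m - 1" z0 "rev (map z [1..<r])" "k - 1"] assms(1-3)
      unfolding A_def U_def V_def formal_polylog_def ws
      by (subst shuffle_sum_commute) (simp add: I_def numeral_2_eq_2)
  qed
  \<comment> \<open>For these \<open>j\<close> both words are nonempty. Shuffles starting with
    \<open>z j\<close> form \<open>A j\<close>; those starting with \<open>z (Suc j)\<close>
    continue with a shuffle of \<open>U j\<close> and \<open>V (Suc j)\<close>, which is
    \<open>A (Suc j)\<close>.\<close>
  have prod: "I (U j) * I (V j) = A j + A (Suc j)" if j: "j \<in> {1..r-1}" for j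
  proof -
    have "U j = z j # U (j - 1)"
      using j by (cases j) (auto simp: U_def)
    moreover have "Suc j \<le> r"
      using j by auto
    then have "V j = z (Suc j) # V (Suc j)"
      by (simp add: V_def upt_conv_Cons del: upt_Suc)
    moreover have "I (U j) * I (V j) = shuffle_sum I (U j) (V j)"
      using assms(5,6)[OF j] unfolding formal_polylog_converges_def U[OF j] V[OF j] I_def
      by (rule iterated_integral_mult)
    ultimately show ?thesis
      by (simp add: A_def)
  qed
  have telescope: "(\<Sum>j=1..n. (-1)^(j-1) * (A j + A (Suc j))) = A 1 - (-1)^n * A (Suc n)" for n
    by (induction n) (auto simp: algebra_simps)
  have "(\<Sum>j=1..r-1. (-1)^(j-1) *
            formal_polylog z0 (rev (map z [1..<j+1])) (replicate (j-1) 1 @ [k]) x *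
            formal_polylog z0 (map z [j+1..<r+1]) (replicate (r-j-1) 1 @ [m]) x) =
      (\<Sum>j=1..r-1. (-1)^(j-1) * (A j + A (Suc j)))"
    by (intro sum.cong refl) (simp only: formal_polylog_def U V mult.assoc I_def flip: prod)
  \<comment> \<open>The sign is \<open>-(-1)^(r-1)\<close>. For \<open>r = 1\<close> the sum is
    empty and the two terms cancel.\<close>
  also have "\<dots> = A 1 + (-1)^r * A r"
    using \<open>r \<ge> 1\<close> telescope[of "r - 1"] by (cases r) simp_all
  finally show ?thesis
    by (simp only: A_first A_last)
qed

end
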